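(* For every integer $n \geq 3$, $$\gamma_s(P_3 \Box C_n) = \begin{cases} n+1 & \text{if } n = 4 \text{ or } n = 7,\\ 3\left\lceil \dfrac{n}{3} \right\rceil & \text{otherwise.}\end{cases}$$
   Context: All graphs are finite, simple and undirected. A set $S\subseteq V(G)$ is dominating in $G$ if every vertex of $G$ not in $S$ has a neighbour in $S$. A set $S\subseteq V(G)$ is secure dominating in $G$ if for every vertex $v\notin S$ there is a vertex $w\in S$ adjacent to $v$ such that $(S\setminus\{w\})\cup\{v\}$ is a dominating set of $G$. The secure domination number $\gamma_s(G)$ is the minimum cardinality of a secure dominating set of $G$. $P_n$ and $C_n$ denote the path and the cycle on $n$ vertices, and $\Box$ denotes the Cartesian product of graphs. *)

theory Defs
  imports "Graph_Theory.Graph_Theory"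
begin

text \<open>
  Finite simple undirected graphs are values of type \<^typ>\<open>'a pair_pre_digraph\<close> satisfying the
  locale \<^locale>\<open>pair_graph\<close>: an edge between u and v is the pair of opposite arcs (u, v), (v, u).
\<close>

definition dominating :: "'a pair_pre_digraph \<Rightarrow> 'a set \<Rightarrow> bool" where
  "dominating G S \<longleftrightarrow>
     S \<subseteq> pverts G \<and> (\<forall>v \<in> pverts G - S. \<exists>w \<in> S. (v, w) \<in> parcs G)"

definition secure_dominating :: "'a pair_pre_digraph \<Rightarrow> 'a set \<Rightarrow> bool" where
  "secure_dominating G S \<longleftrightarrow>
     S \<subseteq> pverts G \<and>
     (\<forall>v \<in> pverts G - S. \<exists>w \<in> S. (v, w) \<in> parcs G \<and> dominating G ((S - {w}) \<union> {v}))"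

definition secure_domination_number :: "'a pair_pre_digraph \<Rightarrow> nat" where
  "secure_domination_number G = (LEAST k. \<exists>S. secure_dominating G S \<and> card S = k)"

definition path_graph :: "nat \<Rightarrow> nat pair_pre_digraph" where
  "path_graph n =
     \<lparr> pverts = {0..<n},
       parcs = {(u, v). u < n \<and> v < n \<and> (v = u + 1 \<or> u = v + 1)} \<rparr>"

text \<open>The cycle on n vertices; this is a simple graph with n edges only for \<^term>\<open>n \<ge> (3::nat)\<close>.\<close>

definition cycle_graph :: "nat \<Rightarrow> nat pair_pre_digraph" where
  "cycle_graph n =
     \<lparr> pverts = {0..<n},
       parcs = {(u, v). u < n \<and> v < n \<and> (v = (u + 1) mod n \<or> u = (v + 1) mod n)} \<rparr>"

definition cartesian_product ::
    "'a pair_pre_digraph \<Rightarrow> 'b pair_pre_digraph \<Rightarrow> ('a \<times> 'b) pair_pre_digraph" where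
  "cartesian_product G H =
     \<lparr> pverts = pverts G \<times> pverts H,
       parcs = {((a, x), (b, y)).
                  (a = b \<and> a \<in> pverts G \<and> (x, y) \<in> parcs H) \<or>
                  ((a, b) \<in> parcs G \<and> x = y \<and> x \<in> pverts H)} \<rparr>"

lemma pair_graph_path_graph: "pair_graph (path_graph n)"
proof -
  have "finite (parcs (path_graph n))"
    by (rule finite_subset[of _ "{0..<n} \<times> {0..<n}"]) (auto simp: path_graph_def)
  then show ?thesis
    by unfold_locales (auto simp: path_graph_def symmetric_def intro!: symI)
qed

lemma pair_graph_cycle_graph:
  assumes "n \<ge> 3"
  shows "pair_graph (cycle_graph n)"
proof -
  have "finite (parcs (cycle_graph n))"
    by (rule finite_subset[of _ "{0..<n} \<times> {0..<n}"]) (auto simp: cycle_graph_def)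
  moreover have "Suc u mod n \<noteq> u" "u \<noteq> Suc u mod n" if "u < n" for u
    using that assms by (cases "Suc u = n"; auto)+
  ultimately show ?thesis
    by unfold_locales (auto simp: cycle_graph_def symmetric_def intro!: symI)
qed

lemma pair_graph_cartesian_product:
  assumes "pair_graph G" and "pair_graph H"
  shows "pair_graph (cartesian_product G H)"
proof -
  interpret G: pair_graph G by fact
  interpret H: pair_graph H by fact
  have sub: "parcs (cartesian_product G H) \<subseteq>
      (pverts G \<times> pverts H) \<times> (pverts G \<times> pverts H)"
    by (auto simp: cartesian_product_def dest: G.in_arcsD1 G.in_arcsD2 H.in_arcsD1 H.in_arcsD2)
  have fin: "finite (pverts (cartesian_product G H))"
    by (simp add: cartesian_product_def G.pair_finite_verts H.pair_finite_verts)
  have "finite (parcs (cartesian_product G H))"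
    by (rule finite_subset[OF sub])
      (simp add: G.pair_finite_verts H.pair_finite_verts)
  moreover have "sym (parcs (cartesian_product G H))"
    using G.pair_sym_arcs H.pair_sym_arcs
    by (auto simp: cartesian_product_def symmetric_def intro!: symI dest: symD)
  moreover have "fst e \<noteq> snd e" if "e \<in> parcs (cartesian_product G H)" for e
    using that by (auto simp: cartesian_product_def dest: G.pair_no_loops H.pair_no_loops)
  moreover have "fst e \<in> pverts (cartesian_product G H)"
    and "snd e \<in> pverts (cartesian_product G H)" if "e \<in> parcs (cartesian_product G H)" for e
    using that sub by (force simp: cartesian_product_def dest: G.in_arcsD1 G.in_arcsD2 H.in_arcsD1 H.in_arcsD2)+
  ultimately show ?thesis
    using fin by unfold_locales (simp_all add: symmetric_def)
qed

text \<open>The whole vertex set is secure dominating, so the minimum is attained.\<close>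

lemma secure_dominating_pverts: "secure_dominating G (pverts G)"
  by (simp add: secure_dominating_def)

lemma secure_domination_number_attained:
  "\<exists>S. secure_dominating G S \<and> card S = secure_domination_number G"
  unfolding secure_domination_number_def
  by (rule LeastI_ex) (use secure_dominating_pverts in blast)

end

theory Submission imports Defs begin

text \<open>For \<open>n \<ge> 4\<close> the graph has no triangles. Then a dominating set is secure dominating iff every guard
  has at most one external private neighbour and every other vertex that is not a private neighbour
  is adjacent to a guard without private neighbours. This is a local condition on a labelling of the
  vertices, so secure dominating sets are closed walks of length n in a finite automaton that reads
  one column at a time, and the theorem is a statement about the cheapest closed walks, a column with
  k guards costing \<open>k - 1\<close>. The cheap walks follow the diagonal pattern of period 3 with one guard per
  column. A closed walk through the diagonal pattern costs at least 0, 2, 1 when n is 0, 1, 2 modulo 3,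
  and a closed walk that avoids it costs at least \<open>n / 9\<close>, which is enough as well; both bounds are
  certified by explicit potentials on the states. Inserting a short defect into the diagonal pattern
  attains the bounds, and the exceptions \<open>n = 4\<close> and \<open>n = 7\<close> are short walks that avoid it.\<close>

subsection \<open>Secure domination as a local labelling\<close>

text \<open>A vertex outside the set is \<open>Private\<close> if it has exactly one neighbour in the set, and
  \<open>Shared\<close> if it has more. A vertex of the set is \<open>Bound\<close> if it may have a private neighbour, and
  \<open>Free\<close> if it has none.\<close>

datatype label = Private | Shared | Free | Bound

fun guard :: "label \<Rightarrow> bool" where
  "guard Private = False" | "guard Shared = False" | "guard Free = True" | "guard Bound = True"

text \<open>A \<open>Private\<close> vertex can be defended only by its single guard, which is then
  not \<open>Free\<close>. A \<open>Shared\<close> vertex needs a \<open>Free\<close> defender,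
  since moving any other guard would abandon a private neighbour.\<close>

fun cell_ok :: "label \<Rightarrow> label list \<Rightarrow> bool" where
  "cell_ok Private ls \<longleftrightarrow> length (filter guard ls) = 1 \<and> Free \<notin> set ls"
| "cell_ok Shared ls \<longleftrightarrow> length (filter guard ls) \<ge> 2 \<and> Free \<in> set ls"
| "cell_ok Free ls \<longleftrightarrow> Private \<notin> set ls"
| "cell_ok Bound ls \<longleftrightarrow> length (filter (\<lambda>l. l = Private) ls) \<le> 1"

lemma cell_ok_cong:
  assumes "mset ls = mset ls'"
  shows "cell_ok l ls = cell_ok l ls'"
proof -
  have "length (filter Q ls) = length (filter Q ls')" for Q
    using assms by (metis mset_filter size_mset)
  moreover have "set ls = set ls'"
    using assms by (rule mset_eq_setD)
  ultimately show ?thesis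
    by (cases l) simp_all
qed

definition nbrs :: "'a pair_pre_digraph \<Rightarrow> 'a \<Rightarrow> 'a set" where
  "nbrs G v = {w. (v, w) \<in> parcs G}"

lemma cell_ok_map:
  assumes "distinct vs"
  shows "cell_ok l (map f vs) \<longleftrightarrow> (case l of
      Private \<Rightarrow> card {w \<in> set vs. guard (f w)} = 1 \<and> (\<forall>w \<in> set vs. f w \<noteq> Free)
    | Shared \<Rightarrow> card {w \<in> set vs. guard (f w)} \<ge> 2 \<and> (\<exists>w \<in> set vs. f w = Free)
    | Free \<Rightarrow> \<forall>w \<in> set vs. f w \<noteq> Private
    | Bound \<Rightarrow> card {w \<in> set vs. f w = Private} \<le> 1)"
proof -
  have "length (filter (Q \<circ> f) vs) = card {w \<in> set vs. Q (f w)}" for Q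
    using assms by (simp add: distinct_length_filter Int_def conj_commute)
  then have "length (filter Q (map f vs)) = card {w \<in> set vs. Q (f w)}" for Q
    by (simp add: filter_map)
  moreover have "l \<in> f ` A \<longleftrightarrow> (\<exists>w \<in> A. f w = l)" for l A
    by auto
  ultimately show ?thesis
    by (cases l) (simp_all del: length_map)
qed

declare cell_ok.simps [simp del]

text \<open>If \<open>w\<close> moves to \<open>v\<close>, a private neighbour of \<open>w\<close>
  other than \<open>v\<close> loses its only guard, and without triangles \<open>v\<close> cannot
  replace it. So a defender of \<open>v\<close> has no private neighbour except possibly
  \<open>v\<close>. This gives the conditions on \<open>Shared\<close> and \<open>Bound\<close>
  cells; the others are immediate from the choice of \<open>f\<close>.\<close>

lemma labelling_of_secure_dominating:
  assumes "pair_graph G" and sec: "secure_dominating G D"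
    and tri: "\<And>u v w. \<lbrakk>(u, v) \<in> parcs G; (v, w) \<in> parcs G\<rbrakk> \<Longrightarrow> (u, w) \<notin> parcs G"
  obtains f where "D = {v \<in> pverts G. guard (f v)}"
    and "\<And>v vs. \<lbrakk>v \<in> pverts G; distinct vs; set vs = nbrs G v\<rbrakk> \<Longrightarrow> cell_ok (f v) (map f vs)"
proof -
  interpret pair_graph G by fact
  have sym: "(v, u) \<in> parcs G" if "(u, v) \<in> parcs G" for u v
    using that pair_sym_arcs by (auto simp: symmetric_def dest: symD)
  have D: "D \<subseteq> pverts G"
    using sec by (simp add: secure_dominating_def)
  define priv where "priv v \<longleftrightarrow> v \<in> pverts G - D \<and> card (nbrs G v \<inter> D) = 1" for v
  define f where "f v = (if v \<in> D then if \<exists>u \<in> nbrs G v. priv u then Bound else Free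
    else if priv v then Private else Shared)" for v
  have guard_f: "guard (f v) \<longleftrightarrow> v \<in> D" for v
    by (auto simp: f_def)
  have Private_f: "f v = Private \<longleftrightarrow> priv v" for v
    by (auto simp: f_def priv_def)
  have Free_f: "f v = Free \<longleftrightarrow> v \<in> D \<and> (\<forall>u \<in> nbrs G v. \<not> priv u)" for v
    by (auto simp: f_def)
  have Bound_f: "f v = Bound \<longleftrightarrow> v \<in> D \<and> (\<exists>u \<in> nbrs G v. priv u)" for v
    by (auto simp: f_def)
  have Shared_f: "f v = Shared \<longleftrightarrow> v \<notin> D \<and> \<not> priv v" for v
    by (auto simp: f_def)
  have fin: "finite (nbrs G v \<inter> D)" for v
    using D finite_subset pair_finite_verts by blast
  have defender: "\<exists>w \<in> nbrs G v \<inter> D. \<forall>u \<in> nbrs G w. priv u \<longrightarrow> u = v"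
    if v: "v \<in> pverts G - D" for v
  proof -
    obtain w where w: "w \<in> D" "(v, w) \<in> parcs G" and dom: "dominating G ((D - {w}) \<union> {v})"
      using sec v unfolding secure_dominating_def by blast
    have "u = v" if u: "u \<in> nbrs G w" "priv u" for u
    proof (rule ccontr)
      assume "u \<noteq> v"
      moreover have "u \<in> pverts G - D"
        using u(2) by (simp add: priv_def)
      ultimately obtain x where x: "x \<in> (D - {w}) \<union> {v}" "(u, x) \<in> parcs G"
        using dom unfolding dominating_def by blast
      \<comment> \<open>\<open>x = v\<close> would close the triangle \<open>v\<close>,
        \<open>w\<close>, \<open>u\<close>; hence \<open>x\<close> and \<open>w\<close> are two old
        guards of \<open>u\<close>.\<close>
      have "x \<noteq> v"
        using tri[of v w u] w(2) u(1) x(2) sym by (auto simp: nbrs_def)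
      then have "{x, w} \<subseteq> nbrs G u \<inter> D" "x \<noteq> w"
        using x w(1) u(1) sym by (auto simp: nbrs_def)
      then have "card {x, w} \<le> card (nbrs G u \<inter> D)" "card {x, w} = 2"
        using card_mono[OF fin] by (blast, simp)
      then show False
        using u(2) by (simp add: priv_def)
    qed
    then show ?thesis
      using w by (auto simp: nbrs_def)
  qed
  show ?thesis
  proof
    show "D = {v \<in> pverts G. guard (f v)}"
      using D by (auto simp: guard_f)
    fix v vs
    assume v: "v \<in> pverts G" and vs: "distinct vs" "set vs = nbrs G v"
    have card_guard: "{w \<in> nbrs G v. guard (f w)} = nbrs G v \<inter> D"
      by (auto simp: guard_f)
    show "cell_ok (f v) (map f vs)"
    proof (cases "f v")
      case Private
      then have p: "priv v"
        by (simp add: Private_f)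
      have "f w \<noteq> Free" if "w \<in> nbrs G v" for w
        using that p sym by (auto simp: Free_f nbrs_def)
      then show ?thesis
        using p vs Private by (simp add: cell_ok_map card_guard priv_def)
    next
      case Shared
      then have n: "v \<in> pverts G - D" "\<not> priv v"
        using v by (auto simp: Shared_f)
      obtain w where w: "w \<in> nbrs G v \<inter> D" "\<forall>u \<in> nbrs G w. priv u \<longrightarrow> u = v"
        using defender[OF n(1)] by blast
      then have "f w = Free"
        using n(2) by (auto simp: Free_f)
      moreover have "card (nbrs G v \<inter> D) \<noteq> 0"
        using w(1) fin by auto
      then have "card (nbrs G v \<inter> D) \<ge> 2"
        using n by (simp add: priv_def)
      ultimately show ?thesis
        using w(1) vs Shared by (auto simp: cell_ok_map card_guard)
    next
      case Free
      then have "\<forall>u \<in> nbrs G v. \<not> priv u"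
        by (simp add: Free_f)
      then show ?thesis
        using vs Free by (simp add: cell_ok_map Private_f)
    next
      case Bound
      then obtain u where u: "u \<in> nbrs G v" "priv u" and vD: "v \<in> D"
        by (auto simp: Bound_f)
      \<comment> \<open>The private neighbour \<open>u\<close> must itself be defended, and its only
        guard \<open>v\<close> is the only candidate.\<close>
      obtain w where w: "w \<in> nbrs G u \<inter> D" "\<forall>x \<in> nbrs G w. priv x \<longrightarrow> x = u"
        using defender[of u] u(2) by (auto simp: priv_def)
      have "card (nbrs G u \<inter> D) = 1" "v \<in> nbrs G u \<inter> D"
        using u vD sym by (auto simp: priv_def nbrs_def)
      then have "w = v"
        using w(1) by (metis card_1_singletonE singletonD)
      then have "{x \<in> nbrs G v. priv x} \<subseteq> {u}"
        using w(2) by auto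
      then have "card {x \<in> nbrs G v. priv x} \<le> 1"
        using card_mono[of "{u}"] by simp
      then show ?thesis
        using vs Bound by (simp add: cell_ok_map Private_f)
    qed
  qed
qed

text \<open>A \<open>Shared\<close> vertex is defended by a \<open>Free\<close> neighbour, a
  \<open>Private\<close> one by its single, \<open>Bound\<close> guard. Either way the defender has
  no private neighbour except possibly the vertex it moves to. Triangles do no harm in this
  direction, so it also serves \<open>n = 3\<close>.\<close>

lemma secure_dominating_of_labelling:
  assumes "pair_graph G"
    and ok: "\<And>v. v \<in> pverts G \<Longrightarrow>
      \<exists>vs. distinct vs \<and> set vs = nbrs G v \<and> cell_ok (f v) (map f vs)"
  shows "secure_dominating G {v \<in> pverts G. guard (f v)}"
proof -
  interpret pair_graph G by fact
  define D where "D = {v \<in> pverts G. guard (f v)}"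
  have sym: "(v, u) \<in> parcs G" if "(u, v) \<in> parcs G" for u v
    using that pair_sym_arcs by (auto simp: symmetric_def dest: symD)
  have in_verts: "u \<in> pverts G" if "u \<in> nbrs G v" for u v
    using that in_arcsD2 by (auto simp: nbrs_def)
  have Private: "card {w \<in> nbrs G v. guard (f w)} = 1 \<and> (\<forall>w \<in> nbrs G v. f w \<noteq> Free)"
    if "v \<in> pverts G" "f v = Private" for v
    using ok[OF that(1)] that(2) by (auto simp: cell_ok_map)
  have Shared: "card {w \<in> nbrs G v. guard (f w)} \<ge> 2 \<and> (\<exists>w \<in> nbrs G v. f w = Free)"
    if "v \<in> pverts G" "f v = Shared" for v
    using ok[OF that(1)] that(2) by (auto simp: cell_ok_map)
  have Free: "\<forall>w \<in> nbrs G v. f w \<noteq> Private" if "v \<in> pverts G" "f v = Free" for v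
    using ok[OF that(1)] that(2) by (auto simp: cell_ok_map)
  have Bound: "card {w \<in> nbrs G v. f w = Private} \<le> 1" if "v \<in> pverts G" "f v = Bound" for v
    using ok[OF that(1)] that(2) by (auto simp: cell_ok_map)
  have fin: "finite (nbrs G v)" for v
    by (rule finite_subset[OF _ pair_finite_verts]) (use in_verts in blast)
  have "\<exists>w \<in> D. (v, w) \<in> parcs G \<and> dominating G ((D - {w}) \<union> {v})" if v: "v \<in> pverts G - D" for v
  proof -
    have "\<exists>w \<in> nbrs G v \<inter> D. \<forall>u \<in> nbrs G w. f u = Private \<longrightarrow> u = v"
    proof (cases "f v")
      case P: Private
      then have "card {w \<in> nbrs G v. guard (f w)} = 1" and nf: "\<forall>w \<in> nbrs G v. f w \<noteq> Free"
        using Private v by auto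
      then obtain w where w: "w \<in> nbrs G v" "guard (f w)"
        by (metis (mono_tags, lifting) card_1_singletonE mem_Collect_eq singletonI)
      then have "f w = Bound"
        using nf by (cases "f w") auto
      then have c: "card {x \<in> nbrs G w. f x = Private} \<le> 1"
        using Bound in_verts w(1) by blast
      have "u = v" if "u \<in> nbrs G w" "f u = Private" for u
      proof -
        have "u \<in> {x \<in> nbrs G w. f x = Private}" "v \<in> {x \<in> nbrs G w. f x = Private}"
          using that P w sym by (auto simp: nbrs_def)
        then show ?thesis
          using c fin card_le_Suc0_iff_eq[of "{x \<in> nbrs G w. f x = Private}"] by auto
      qed
      then show ?thesis
        using w in_verts by (auto simp: D_def)
    next
      case S: Shared
      then obtain w where "w \<in> nbrs G v" "f w = Free"
        using Shared v by blast
      then show ?thesis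
        using Free in_verts by (force simp: D_def)
    qed (use v in \<open>auto simp: D_def\<close>)
    then obtain w where w: "w \<in> nbrs G v" "w \<in> D" "\<forall>u \<in> nbrs G w. f u = Private \<longrightarrow> u = v"
      by blast
    have "\<exists>x \<in> (D - {w}) \<union> {v}. (u, x) \<in> parcs G"
      if u: "u \<in> pverts G - ((D - {w}) \<union> {v})" for u
    proof (cases "u = w")
      case True
      then show ?thesis
        using w(1) sym by (auto simp: nbrs_def)
    next
      case False
      then have "\<not> guard (f u)"
        using u by (auto simp: D_def)
      define X where "X = {x \<in> nbrs G u. guard (f x)}"
      \<comment> \<open>Only the guard \<open>w\<close> has left. A \<open>Shared\<close>
        \<open>u\<close> had a second guard, and the guard of a \<open>Private\<close>
        \<open>u\<close> is not \<open>w\<close>, because \<open>u\<close> differs from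
        \<open>v\<close>.\<close>
      have "card X = 1 \<and> w \<notin> X \<or> card X \<ge> 2"
        using \<open>\<not> guard (f u)\<close> Private[of u] Shared[of u] w(3) u sym
        by (cases "f u") (auto simp: X_def nbrs_def)
      then have "\<not> X \<subseteq> {w}"
        by (auto simp: subset_singleton_iff)
      then show ?thesis
        using in_verts by (fastforce simp: X_def D_def nbrs_def)
    qed
    moreover have "(D - {w}) \<union> {v} \<subseteq> pverts G"
      using v by (auto simp: D_def)
    ultimately show ?thesis
      using w by (auto simp: dominating_def nbrs_def)
  qed
  then have "secure_dominating G D"
    by (auto simp: secure_dominating_def D_def)
  then show ?thesis
    by (simp add: D_def)
qed

subsection \<open>Labellings of the cylinder\<close>

text \<open>The three rows of the cylinder, unrolled to infinite sequences.\<close>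

definition strip :: "(nat \<Rightarrow> label) \<Rightarrow> (nat \<Rightarrow> label) \<Rightarrow> (nat \<Rightarrow> label) \<Rightarrow> bool" where
  "strip a b c \<longleftrightarrow> (\<forall>i.
     cell_ok (a (i + 1)) [a (i + 2), a i, b (i + 1)] \<and>
     cell_ok (b (i + 1)) [b (i + 2), b i, a (i + 1), c (i + 1)] \<and>
     cell_ok (c (i + 1)) [c (i + 2), c i, b (i + 1)])"

definition weight :: "label \<Rightarrow> label \<Rightarrow> label \<Rightarrow> nat" where
  "weight a b c = of_bool (guard a) + of_bool (guard b) + of_bool (guard c)"

section \<open>The cylinder graph and its neighbourhoods\<close>

abbreviation cylinder :: "nat \<Rightarrow> (nat \<times> nat) pair_pre_digraph" where
  "cylinder n \<equiv> cartesian_product (path_graph 3) (cycle_graph n)"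

lemma pair_graph_cylinder: "n \<ge> 3 \<Longrightarrow> pair_graph (cylinder n)"
  by (intro pair_graph_cartesian_product pair_graph_path_graph pair_graph_cycle_graph)

lemma pverts_cylinder: "pverts (cylinder n) = {0..<3} \<times> {0..<n}"
  by (simp add: cartesian_product_def path_graph_def cycle_graph_def)

lemma Suc_mod_if: "u < n \<Longrightarrow> Suc u mod n = (if Suc u = n then 0 else Suc u)"
  by auto

text \<open>Writing the vertex as a successor modulo \<open>n\<close> names both neighbours without
  subtraction; \<open>strip\<close> follows the same convention.\<close>

lemma cycle_arc_iff:
  assumes "n \<ge> 3"
  shows "(Suc i mod n, j) \<in> parcs (cycle_graph n) \<longleftrightarrow> j = (i + 2) mod n \<or> j = i mod n"
proof -
  define k where "k = i mod n"
  have k: "k < n"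
    using assms by (simp add: k_def)
  define m where "m = Suc k mod n"
  have m: "m = (if Suc k = n then 0 else Suc k)"
    using k by (simp add: m_def)
  have "Suc i mod n = m" "(i + 2) mod n = Suc m mod n"
    by (simp_all add: m_def k_def mod_Suc_eq mod_Suc_Suc_eq)
  moreover have "(m, j) \<in> parcs (cycle_graph n) \<longleftrightarrow> j = Suc m mod n \<or> j = k"
    using k assms by (cases "j < n") (auto simp: cycle_graph_def m Suc_mod_if)
  ultimately show ?thesis
    by (simp add: k_def)
qed

lemma cycle_no_loop: "n \<ge> 3 \<Longrightarrow> (u, u) \<notin> parcs (cycle_graph n)"
  by (auto simp: cycle_graph_def Suc_mod_if split: if_splits)

text \<open>Each arc changes the position by 1 or -1 modulo \<open>n\<close>. A triangle would make
  a sum of three such changes, one of -3, -1, 1, 3, divisible by \<open>n\<close>.\<close>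

lemma cycle_no_triangle:
  assumes "n \<ge> 4" "(u, v) \<in> parcs (cycle_graph n)" "(v, w) \<in> parcs (cycle_graph n)"
  shows "(u, w) \<notin> parcs (cycle_graph n)"
proof -
  have arc: "x < n \<and> y < n \<and> (y = Suc x \<or> x = Suc y \<or> Suc x = n \<and> y = 0 \<or> Suc y = n \<and> x = 0)"
    if "(x, y) \<in> parcs (cycle_graph n)" for x y
    using that by (auto simp: cycle_graph_def Suc_mod_if split: if_splits)
  show ?thesis
    using arc[OF assms(2)] arc[OF assms(3)] arc[of u w] assms(1) by linarith
qed

lemma cylinder_arc_iff:
  "((r, x), (s, y)) \<in> parcs (cylinder n) \<longleftrightarrow>
     r = s \<and> r < 3 \<and> (x, y) \<in> parcs (cycle_graph n) \<or>
     x = y \<and> x < n \<and> r < 3 \<and> s < 3 \<and> (s = Suc r \<or> r = Suc s)"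
  by (auto simp: cartesian_product_def path_graph_def cycle_graph_def)

text \<open>The path is bipartite, so a triangle has an even number of path arcs. With two of them
  the third arc would be a loop of the cycle; with none the triangle lies in the cycle.\<close>

lemma cylinder_no_triangle:
  assumes n: "n \<ge> 4" and arcs: "(u, v) \<in> parcs (cylinder n)" "(v, w) \<in> parcs (cylinder n)"
  shows "(u, w) \<notin> parcs (cylinder n)"
proof
  assume uw: "(u, w) \<in> parcs (cylinder n)"
  obtain r x s y t z where uvw: "u = (r, x)" "v = (s, y)" "w = (t, z)"
    by (metis prod.exhaust)
  have "(k, k) \<notin> parcs (cycle_graph n)" for k
    using n by (intro cycle_no_loop) simp
  then show False
    using arcs uw cycle_no_triangle[OF n, of x y z] unfolding uvw cylinder_arc_iff
    by (cases "x = y"; cases "y = z"; cases "x = z") (simp_all, linarith)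
qed

text \<open>The right neighbour stands first, since \<open>cell_ok_Cons\<close> later separates it
  from the neighbours already known.\<close>

definition cylinder_nbrs :: "nat \<Rightarrow> nat \<Rightarrow> nat \<Rightarrow> (nat \<times> nat) list" where
  "cylinder_nbrs n r i = (r, (i + 2) mod n) # (r, i mod n) #
     map (\<lambda>q. (q, Suc i mod n)) (if r = 1 then [0, 2] else [1])"

lemma cylinder_nbrs:
  assumes "n \<ge> 3" "r < 3"
  shows "distinct (cylinder_nbrs n r i)"
    and "set (cylinder_nbrs n r i) = nbrs (cylinder n) (r, Suc i mod n)"
proof -
  have "(i + 2) mod n \<noteq> i mod n"
  proof -
    define k where "k = i mod n"
    have k: "k < n"
      using assms by (simp add: k_def)
    have "(i + 2) mod n = Suc (Suc k mod n) mod n"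
      by (simp add: k_def mod_Suc_eq mod_Suc_Suc_eq)
    also have "\<dots> \<noteq> k"
      using k assms(1) by (simp add: Suc_mod_if)
    finally show ?thesis
      by (simp add: k_def)
  qed
  moreover have "r = 0 \<or> r = 1 \<or> r = 2"
    using assms(2) by linarith
  ultimately show "distinct (cylinder_nbrs n r i)"
    by (auto simp: cylinder_nbrs_def)
  define j j' m where "j = i mod n" and "j' = (i + 2) mod n" and "m = Suc i mod n"
  have "m < n"
    using assms by (simp add: m_def)
  then have "(s, y) \<in> nbrs (cylinder n) (r, m) \<longleftrightarrow>
      s = r \<and> (y = j' \<or> y = j) \<or> y = m \<and> s < 3 \<and> (s = Suc r \<or> r = Suc s)" for s y
    using cycle_arc_iff[OF assms(1), of i y] assms(2)
    unfolding nbrs_def mem_Collect_eq cylinder_arc_iff m_def[symmetric] j_def[symmetric] j'_def[symmetric]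
    by blast
  then have "v \<in> nbrs (cylinder n) (r, m) \<longleftrightarrow>
      fst v = r \<and> (snd v = j' \<or> snd v = j) \<or> snd v = m \<and> fst v < 3 \<and> (fst v = Suc r \<or> r = Suc (fst v))" for v
    by (metis prod.collapse)
  moreover have "v \<in> set (cylinder_nbrs n r i) \<longleftrightarrow>
      fst v = r \<and> (snd v = j' \<or> snd v = j) \<or> snd v = m \<and> fst v < 3 \<and> (fst v = Suc r \<or> r = Suc (fst v))" for v
    using \<open>r = 0 \<or> r = 1 \<or> r = 2\<close>
    unfolding cylinder_nbrs_def m_def[symmetric] j_def[symmetric] j'_def[symmetric]
    by (cases v) auto
  ultimately show "set (cylinder_nbrs n r i) = nbrs (cylinder n) (r, Suc i mod n)"
    unfolding m_def[symmetric] by blast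
qed

lemma card_guards:
  fixes f :: "nat \<times> nat \<Rightarrow> label"
  shows "card {v \<in> pverts (cylinder n). guard (f v)} =
    (\<Sum>j<n. weight (f (0, j)) (f (1, j)) (f (2, j)))"
proof -
  have "card {v \<in> {0..<3} \<times> {0..<n}. guard (f v)} = (\<Sum>v \<in> {0..<3} \<times> {0..<n}. of_bool (guard (f v)))"
    by (simp add: Int_def)
  also have "\<dots> = (\<Sum>r = 0..<3. \<Sum>j = 0..<n. of_bool (guard (f (r, j))))"
    by (simp only: sum.cartesian_product split_def prod.collapse)
  also have "\<dots> = (\<Sum>j = 0..<n. \<Sum>r = 0..<3. of_bool (guard (f (r, j))))"
    by (rule sum.swap)
  also have "\<dots> = (\<Sum>j<n. weight (f (0, j)) (f (1, j)) (f (2, j)))"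
    by (simp add: weight_def numeral_3_eq_3 numeral_2_eq_2 atLeast0LessThan del: sum_of_bool_eq)
  finally show ?thesis
    by (simp add: pverts_cylinder)
qed

lemma strip_of_secure_dominating:
  assumes n: "n \<ge> 4" and sec: "secure_dominating (cylinder n) D"
  obtains a b c where "strip a b c"
    and "\<And>i. a (i + n) = a i" "\<And>i. b (i + n) = b i" "\<And>i. c (i + n) = c i"
    and "card D = (\<Sum>j<n. weight (a j) (b j) (c j))"
proof -
  have n3: "n \<ge> 3"
    using n by simp
  obtain f where f: "D = {v \<in> pverts (cylinder n). guard (f v)}"
    and ok: "\<And>v vs. \<lbrakk>v \<in> pverts (cylinder n); distinct vs; set vs = nbrs (cylinder n) v\<rbrakk>
      \<Longrightarrow> cell_ok (f v) (map f vs)"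
    by (rule labelling_of_secure_dominating[OF pair_graph_cylinder[OF n3] sec])
      (use cylinder_no_triangle[OF n] in blast)+
  have cell: "cell_ok (f (r, Suc i mod n)) (map f (cylinder_nbrs n r i))" if "r < 3" for r i
    using that n by (intro ok cylinder_nbrs n3) (auto simp: pverts_cylinder)
  define row where "row r i = f (r, i mod n)" for r i :: nat
  show ?thesis
  proof
    show "strip (row 0) (row 1) (row 2)"
      using cell[of 0] cell[of 1] cell[of 2] by (simp add: strip_def row_def cylinder_nbrs_def)
    show "card D = (\<Sum>j<n. weight (row 0 j) (row 1 j) (row 2 j))"
      unfolding f card_guards by (simp add: row_def)
  qed (simp_all add: row_def)
qed

lemma secure_dominating_of_strip:
  assumes n: "n \<ge> 3" and st: "strip a b c"
    and per: "\<And>i. a (i mod n) = a i" "\<And>i. b (i mod n) = b i" "\<And>i. c (i mod n) = c i"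
  shows "\<exists>D. secure_dominating (cylinder n) D \<and> card D = (\<Sum>j<n. weight (a j) (b j) (c j))"
proof -
  define f where "f v = (case v of (r, j) \<Rightarrow> if r = 0 then a j else if r = 1 then b j else c j)"
    for v :: "nat \<times> nat"
  have f: "f (0, j) = a j" "f (1, j) = b j" "f (2, j) = c j" for j
    by (simp_all add: f_def)
  have "secure_dominating (cylinder n) {v \<in> pverts (cylinder n). guard (f v)}"
  proof (rule secure_dominating_of_labelling[OF pair_graph_cylinder[OF n]])
    fix v assume v: "v \<in> pverts (cylinder n)"
    obtain r j where rj: "v = (r, j)" "r < 3" "j < n"
      using v by (auto simp: pverts_cylinder)
    \<comment> \<open>Adding \<open>n - 1\<close> steps back one column modulo \<open>n\<close>,
      which makes \<open>j\<close> the centre column of \<open>strip\<close> at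
      \<open>i\<close>.\<close>
    have j: "j = Suc (j + (n - 1)) mod n"
      using rj(3) by simp
    define i where "i = j + (n - 1)"
    have "r = 0 \<or> r = 1 \<or> r = 2"
      using rj(2) by linarith
    moreover have v_eq: "v = (r, Suc i mod n)"
      using j rj(1) by (simp add: i_def)
    ultimately have "cell_ok (f v) (map f (cylinder_nbrs n r i))"
      using st[unfolded strip_def, rule_format, of i]
      by (auto simp: cylinder_nbrs_def f f[unfolded One_nat_def] per)
    with v_eq show "\<exists>vs. distinct vs \<and> set vs = nbrs (cylinder n) v \<and> cell_ok (f v) (map f vs)"
      using cylinder_nbrs[OF n rj(2), of i] by metis
  qed
  then show ?thesis
    using card_guards[of n f] f by auto
qed

subsection \<open>Upper bounds\<close>

type_synonym column = "label \<times> label \<times> label"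

fun fits :: "column \<Rightarrow> column \<Rightarrow> column \<Rightarrow> bool" where
  "fits (a, b, c) (a', b', c') (a'', b'', c'') \<longleftrightarrow>
     cell_ok a' [a'', a, b'] \<and> cell_ok b' [b'', b, a', c'] \<and> cell_ok c' [c'', c, b']"

fun chain :: "column list \<Rightarrow> bool" where
  "chain (x # y # z # xs) \<longleftrightarrow> fits x y z \<and> chain (y # z # xs)"
| "chain _ \<longleftrightarrow> True"

definition num_guards :: "column list \<Rightarrow> nat" where
  "num_guards xs = (\<Sum>(a, b, c) \<leftarrow> xs. weight a b c)"

lemma chain_nth:
  "\<lbrakk>chain xs; k + 2 < length xs\<rbrakk> \<Longrightarrow> fits (xs ! k) (xs ! (k + 1)) (xs ! (k + 2))"
proof (induction xs arbitrary: k rule: chain.induct)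
  case (1 x y z xs)
  then show ?case
    by (cases k) simp_all
qed simp_all

lemma secure_domination_number_le:
  "secure_dominating G D \<Longrightarrow> secure_domination_number G \<le> card D"
  unfolding secure_domination_number_def by (rule Least_le) blast

text \<open>Appending the first two columns lets \<open>chain\<close> check the two windows across
  the seam as well, so the word closes up around the cycle.\<close>

lemma secure_domination_number_le_num_guards:
  assumes n: "length w = n" "n \<ge> 3" and chain: "chain (w @ take 2 w)"
  shows "secure_domination_number (cylinder n) \<le> num_guards w"
proof -
  define col where "col i = w ! (i mod n)" for i
  define a b c where "a i = fst (col i)" and "b i = fst (snd (col i))" and "c i = snd (snd (col i))" for i
  have wrap: "(w @ take 2 w) ! m = col m" if "m < n + 2" for m
    using that n by (cases "m < n") (auto simp: col_def nth_append le_mod_geq)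
  have fits: "fits (col i) (col (i + 1)) (col (i + 2))" for i
  proof -
    have "i mod n < n"
      using n(2) by simp
    then have "i mod n < n + 2" "i mod n + 1 < n + 2" "i mod n + 2 < n + 2"
      by simp_all
    note wraps = this[THEN wrap]
    have "fits (col (i mod n)) (col (i mod n + 1)) (col (i mod n + 2))"
      using chain_nth[OF chain, of "i mod n"] n \<open>i mod n < n\<close> unfolding wraps by simp
    then show ?thesis
      by (simp add: col_def mod_Suc_eq mod_Suc_Suc_eq)
  qed
  have "strip a b c"
    unfolding strip_def
  proof
    fix i
    show "cell_ok (a (i + 1)) [a (i + 2), a i, b (i + 1)] \<and>
      cell_ok (b (i + 1)) [b (i + 2), b i, a (i + 1), c (i + 1)] \<and>
      cell_ok (c (i + 1)) [c (i + 2), c i, b (i + 1)]"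
      using fits[of i]
      by (cases "col i"; cases "col (i + 1)"; cases "col (i + 2)") (simp add: a_def b_def c_def)
  qed
  then obtain D where D: "secure_dominating (cylinder n) D"
      "card D = (\<Sum>j<n. weight (a j) (b j) (c j))"
    using secure_dominating_of_strip[OF n(2), of a b c] by (auto simp: a_def b_def c_def col_def)
  have "num_guards w = (\<Sum>j<n. weight (a j) (b j) (c j))"
    by (simp add: num_guards_def sum_list_sum_nth n(1) atLeast0LessThan a_def b_def c_def col_def split_def)
  then show ?thesis
    using secure_domination_number_le[OF D(1)] D(2) by simp
qed

text \<open>Every word in question begins with \<open>x\<close>, \<open>y\<close>, so one more block
  \<open>x\<close>, \<open>y\<close>, \<open>z\<close> in front creates only the three windows of
  the periodic pattern. Checking the closing word \<open>x # y # t\<close> once therefore settles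
  all \<open>k\<close>.\<close>

lemma secure_domination_number_le_periodic:
  assumes "fits x y z" "fits y z x" "fits z x y" "chain (x # y # t @ [x, y])"
    and n: "n = 3 * k + length t + 2" "n \<ge> 3"
  shows "secure_domination_number (cylinder n) \<le> k * num_guards [x, y, z] + num_guards (x # y # t)"
proof -
  define w where "w k = concat (replicate k [x, y, z]) @ x # y # t" for k
  have start: "\<exists>r. w k @ [x, y] = x # y # r" for k
    by (cases k) (auto simp: w_def)
  have "chain (w k @ [x, y])"
  proof (induction k)
    case 0
    then show ?case
      using assms(4) by (simp add: w_def)
  next
    case (Suc k)
    obtain r where r: "w k @ [x, y] = x # y # r"
      using start by blast
    then have "w (Suc k) @ [x, y] = x # y # z # x # y # r"
      by (simp add: w_def)
    then show ?case
      using Suc r assms(1-3) by simp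
  qed
  moreover have "take 2 (w k) = [x, y]"
    by (cases k) (auto simp: w_def)
  moreover have "length (w k) = n"
    by (simp add: w_def n(1) length_concat sum_list_replicate)
  moreover have "num_guards (w k) = k * num_guards [x, y, z] + num_guards (x # y # t)"
    by (induction k) (auto simp: w_def num_guards_def)
  ultimately show ?thesis
    using secure_domination_number_le_num_guards[of "w k" n] n(2) by simp
qed

lemma upper_bound:
  assumes "n \<ge> 3"
  shows "secure_domination_number (cylinder n) \<le> (if n = 4 \<or> n = 7 then n + 1 else 3 * ((n + 2) div 3))"
proof -
  \<comment> \<open>The diagonal pattern: the single guard of a column runs through the middle,
    third and first rows.\<close>
  define x y z where "x = (Shared, Free, Shared)" and "y = (Private, Shared, Bound)"
    and "z = (Bound, Shared, Private)"
  note xyz = x_def y_def z_def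
  have diagonal: "fits x y z" "fits y z x" "fits z x y" "num_guards [x, y, z] = 3"
    by (simp_all add: xyz cell_ok.simps num_guards_def weight_def)
  note periodic = secure_domination_number_le_periodic[OF diagonal(1-3)]
  \<comment> \<open>The residues 0, 2, 1 modulo 3 use closing words with 0, 1, 2 guards more than
    columns. An excess of 2 is one too many for \<open>n = 4\<close> and \<open>n = 7\<close>, which
    get words of their own.\<close>
  consider "n = 4" | "n = 7" | k where "n = 3 * k + 3" | k where "n = 3 * k + 5"
    | k where "n = 3 * k + 4" "k \<ge> 2"
  proof -
    have "\<exists>k. n = 3 * k + 3 \<or> n = 3 * k + 4 \<or> n = 3 * k + 5"
      using assms by presburger
    then obtain k where "n = 3 * k + 3 \<or> n = 3 * k + 4 \<or> n = 3 * k + 5"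
      by blast
    moreover have "k = 0 \<or> k = 1 \<or> k \<ge> 2"
      by linarith
    ultimately show thesis
      using that by auto
  qed
  then show ?thesis
  proof cases
    case 1
    let ?w = "[(Private, Shared, Free), (Private, Bound, Shared), (Shared, Free, Shared),
      (Bound, Shared, Free)]"
    have "chain (?w @ take 2 ?w)" "num_guards ?w = 5"
      by (simp_all add: cell_ok.simps num_guards_def weight_def)
    then show ?thesis
      using secure_domination_number_le_num_guards[of ?w n] 1 by simp
  next
    case 2
    let ?w = "[(Free, Shared, Private), (Shared, Shared, Bound), (Free, Free, Shared),
      (Shared, Shared, Bound), (Free, Shared, Private), (Shared, Bound, Private), (Shared, Bound, Private)]"
    have "chain (?w @ take 2 ?w)" "num_guards ?w = 8"
      by (simp_all add: cell_ok.simps num_guards_def weight_def)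
    then show ?thesis
      using secure_domination_number_le_num_guards[of ?w n] 2 by simp
  next
    case (3 k)
    have "chain (x # y # [z] @ [x, y])" "num_guards [x, y, z] = 3"
      by (simp_all add: xyz cell_ok.simps num_guards_def weight_def)
    then have "secure_domination_number (cylinder n) \<le> 3 * (k + 1)"
      using periodic[of "[z]" n k] 3 diagonal(4) by simp
    moreover have "(n + 2) div 3 = k + 1" "n \<noteq> 4" "n \<noteq> 7"
      using 3 by presburger+
    ultimately show ?thesis
      by simp
  next
    case (4 k)
    let ?t = "[z, (Shared, Free, Shared), (Free, Shared, Free)]"
    have "chain (x # y # ?t @ [x, y])" "num_guards (x # y # ?t) = 6"
      by (simp_all add: xyz cell_ok.simps num_guards_def weight_def)
    then have "secure_domination_number (cylinder n) \<le> 3 * (k + 2)"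
      using periodic[of ?t n k] 4 diagonal(4) by simp
    moreover have "(n + 2) div 3 = k + 2" "n \<noteq> 4" "n \<noteq> 7"
      using 4 by presburger+
    ultimately show ?thesis
      by simp
  next
    case (5 k)
    let ?t = "[(Bound, Shared, Shared), (Free, Free, Free)]"
    have "chain (x # y # ?t @ [x, y])" "num_guards (x # y # ?t) = 6"
      by (simp_all add: xyz cell_ok.simps num_guards_def weight_def)
    then have "secure_domination_number (cylinder n) \<le> 3 * (k + 2)"
      using periodic[of ?t n k] 5 diagonal(4) by simp
    moreover have "(n + 2) div 3 = k + 2" "n \<noteq> 4" "n \<noteq> 7"
      using 5 by presburger+
    ultimately show ?thesis
      by simp
  qed
qed

subsection \<open>The transfer automaton\<close>

text \<open>A front records what a cell still demands of its right neighbour once its other neighbours are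
  known. Private: \<open>P0\<close> has its guard already, \<open>P1\<close> waits for it. Shared: \<open>S0\<close>, \<open>SG\<close>, \<open>SF\<close> demand
  nothing, a guard, a free guard. Free: \<open>FF\<close>. Bound: \<open>T0\<close> and \<open>T1\<close> tolerate no and one further
  private neighbour.\<close>

datatype front = P0 | P1 | S0 | SG | SF | FF | T0 | T1

fun label_of :: "front \<Rightarrow> label" where
  "label_of P0 = Private" | "label_of P1 = Private"
| "label_of S0 = Shared" | "label_of SG = Shared" | "label_of SF = Shared"
| "label_of FF = Free" | "label_of T0 = Bound" | "label_of T1 = Bound"

fun admits :: "front \<Rightarrow> label \<Rightarrow> bool" where
  "admits P0 l \<longleftrightarrow> \<not> guard l"
| "admits P1 l \<longleftrightarrow> l = Bound"
| "admits S0 l \<longleftrightarrow> True"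
| "admits SG l \<longleftrightarrow> guard l"
| "admits SF l \<longleftrightarrow> l = Free"
| "admits FF l \<longleftrightarrow> l \<noteq> Private"
| "admits T0 l \<longleftrightarrow> l \<noteq> Private"
| "admits T1 l \<longleftrightarrow> True"

text \<open>Collects what no right neighbour can repair. A \<open>Shared\<close> cell needs two
  guards and has one neighbour left, so one guard must already be present.\<close>

fun live :: "label \<Rightarrow> label list \<Rightarrow> bool" where
  "live Private ls \<longleftrightarrow> length (filter guard ls) \<le> 1 \<and> Free \<notin> set ls"
| "live Shared ls \<longleftrightarrow> filter guard ls \<noteq> []"
| "live Free ls \<longleftrightarrow> Private \<notin> set ls"
| "live Bound ls \<longleftrightarrow> length (filter (\<lambda>l. l = Private) ls) \<le> 1"

fun advance :: "label \<Rightarrow> label list \<Rightarrow> front" where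
  "advance Private ls = (if filter guard ls = [] then P1 else P0)"
| "advance Shared ls = (if Free \<notin> set ls then SF else if length (filter guard ls) \<ge> 2 then S0 else SG)"
| "advance Free ls = FF"
| "advance Bound ls = (if Private \<in> set ls then T0 else T1)"

text \<open>The few fronts suffice because a \<open>Shared\<close> cell without a
  \<open>Free\<close> neighbour so far must get one on the right, and that guard also serves as the
  second guard.\<close>

lemma cell_ok_Cons: "cell_ok l (r # ls) \<longleftrightarrow> live l ls \<and> admits (advance l ls) r"
proof (cases l)
  case Private
  then show ?thesis
    by (cases r; cases "filter guard ls") (auto simp: cell_ok.simps)
next
  case Shared
  have "Free \<in> set ls \<Longrightarrow> Free \<in> set (filter guard ls)"
    by simp
  then show ?thesis
    using Shared by (cases r; cases "filter guard ls") (auto simp: cell_ok.simps Suc_le_eq)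
next
  case Free
  then show ?thesis
    by (cases r) (auto simp: cell_ok.simps)
next
  case Bound
  have "Private \<in> set ls \<longleftrightarrow> filter (\<lambda>l. l = Private) ls \<noteq> []"
    by (auto simp: filter_empty_conv)
  then show ?thesis
    using Bound by (cases r; cases "filter (\<lambda>l. l = Private) ls") (auto simp: cell_ok.simps)
qed

lemma label_of_advance [simp]: "label_of (advance l ls) = l"
  by (cases l) auto

lemma advance_cong:
  assumes "mset ls = mset ls'"
  shows "advance l ls = advance l ls'"
proof -
  have "length (filter guard ls) = length (filter guard ls')"
    using assms by (metis mset_filter size_mset)
  moreover from this have "filter guard ls = [] \<longleftrightarrow> filter guard ls' = []"
    by (metis length_0_conv)
  moreover have "set ls = set ls'"
    using assms by (rule mset_eq_setD)
  ultimately show ?thesis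
    by (cases l) simp_all
qed

text \<open>The certificate consists of four potentials on triples of fronts, found by shortest path
  computations. The first three bound from below the number of guards in excess of one per column
  that a walk starting in \<open>(S0, FF, SG)\<close> has spent after 0, 1, 2 steps modulo 3. The fourth shows
  that a walk avoiding the states of \<open>middle\<close>, which are those of the two diagonal patterns
  after the column with the guard in the middle row, spends at least \<open>1/9\<close> of a guard in excess
  per column.\<close>

type_synonym cert = "nat \<times> nat \<times> nat \<times> nat"

definition cert_P0 :: "front \<Rightarrow> front \<Rightarrow> cert" where
  "cert_P0 b c = (case b of
    P0 \<Rightarrow> (case c of P0 \<Rightarrow> (2, 2, 1, 10) | P1 \<Rightarrow> (1, 1, 1, 8) | SG \<Rightarrow> (2, 2, 1, 10) | SF \<Rightarrow> (2, 2, 1, 10) | T0 \<Rightarrow> (1, 2, 1, 13) | _ \<Rightarrow> (3, 3, 3, 20))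
    | P1 \<Rightarrow> (case c of P0 \<Rightarrow> (1, 1, 0, 7) | P1 \<Rightarrow> (0, 1, 0, 4) | SG \<Rightarrow> (1, 1, 0, 7) | SF \<Rightarrow> (1, 1, 0, 7) | _ \<Rightarrow> (3, 3, 3, 20))
    | S0 \<Rightarrow> (case c of FF \<Rightarrow> (2, 1, 2, 14) | T0 \<Rightarrow> (3, 3, 3, 19) | T1 \<Rightarrow> (2, 1, 2, 14) | _ \<Rightarrow> (3, 3, 3, 20))
    | SG \<Rightarrow> (case c of P0 \<Rightarrow> (2, 1, 1, 10) | P1 \<Rightarrow> (1, 1, 1, 5) | SG \<Rightarrow> (2, 1, 1, 10) | SF \<Rightarrow> (2, 1, 1, 10) | FF \<Rightarrow> (1, 2, 1, 11) | _ \<Rightarrow> (3, 3, 3, 20))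
    | SF \<Rightarrow> (case c of P0 \<Rightarrow> (2, 1, 1, 10) | P1 \<Rightarrow> (1, 1, 1, 8) | SG \<Rightarrow> (2, 1, 1, 10) | SF \<Rightarrow> (2, 1, 1, 10) | T0 \<Rightarrow> (1, 1, 1, 8) | T1 \<Rightarrow> (1, 2, 1, 13) | _ \<Rightarrow> (3, 3, 3, 20))
    | T0 \<Rightarrow> (case c of S0 \<Rightarrow> (1, 1, 1, 10) | SF \<Rightarrow> (1, 1, 1, 9) | FF \<Rightarrow> (2, 1, 2, 17) | T0 \<Rightarrow> (2, 2, 2, 13) | T1 \<Rightarrow> (2, 1, 2, 18) | _ \<Rightarrow> (3, 3, 3, 20))
    | _ \<Rightarrow> (3, 3, 3, 20))"

definition cert_P1 :: "front \<Rightarrow> front \<Rightarrow> cert" where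
  "cert_P1 b c = (case b of
    P0 \<Rightarrow> (case c of P0 \<Rightarrow> (1, 1, 1, 8) | P1 \<Rightarrow> (0, 1, 1, 3) | SG \<Rightarrow> (1, 1, 1, 8) | SF \<Rightarrow> (1, 1, 1, 6) | T0 \<Rightarrow> (1, 1, 1, 9) | _ \<Rightarrow> (3, 3, 3, 20))
    | P1 \<Rightarrow> (case c of P0 \<Rightarrow> (1, 1, 0, 4) | P1 \<Rightarrow> (0, 1, 1, 0) | SG \<Rightarrow> (1, 1, 0, 4) | SF \<Rightarrow> (0, 0, 0, 3) | _ \<Rightarrow> (3, 3, 3, 20))
    | S0 \<Rightarrow> (case c of FF \<Rightarrow> (1, 0, 1, 8) | T0 \<Rightarrow> (3, 3, 3, 19) | T1 \<Rightarrow> (1, 0, 2, 9) | _ \<Rightarrow> (3, 3, 3, 20))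
    | SG \<Rightarrow> (case c of P0 \<Rightarrow> (1, 0, 1, 5) | P1 \<Rightarrow> (0, 0, 1, 0) | SG \<Rightarrow> (1, 0, 1, 5) | SF \<Rightarrow> (1, 0, 1, 5) | FF \<Rightarrow> (1, 1, 1, 9) | _ \<Rightarrow> (3, 3, 3, 20))
    | SF \<Rightarrow> (case c of P0 \<Rightarrow> (1, 1, 0, 8) | P1 \<Rightarrow> (0, 0, 0, 0) | SG \<Rightarrow> (1, 1, 0, 7) | SF \<Rightarrow> (1, 1, 0, 3) | T0 \<Rightarrow> (1, 1, 1, 7) | T1 \<Rightarrow> (1, 1, 1, 9) | _ \<Rightarrow> (3, 3, 3, 20))
    | _ \<Rightarrow> (3, 3, 3, 20))"

definition cert_S0 :: "front \<Rightarrow> front \<Rightarrow> cert" where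
  "cert_S0 b c = (case b of
    FF \<Rightarrow> (case c of S0 \<Rightarrow> (1, 2, 1, 10) | SG \<Rightarrow> (0, 2, 1, 20) | FF \<Rightarrow> (1, 2, 2, 15) | T0 \<Rightarrow> (2, 2, 2, 15) | T1 \<Rightarrow> (1, 2, 2, 15) | _ \<Rightarrow> (3, 3, 3, 20))
    | T0 \<Rightarrow> (case c of P0 \<Rightarrow> (1, 2, 1, 10) | S0 \<Rightarrow> (3, 3, 3, 19) | SF \<Rightarrow> (3, 3, 3, 19) | _ \<Rightarrow> (3, 3, 3, 20))
    | T1 \<Rightarrow> (case c of S0 \<Rightarrow> (2, 2, 1, 13) | SF \<Rightarrow> (1, 2, 1, 10) | FF \<Rightarrow> (2, 2, 2, 18) | T0 \<Rightarrow> (2, 2, 2, 16) | T1 \<Rightarrow> (2, 2, 2, 18) | _ \<Rightarrow> (3, 3, 3, 20))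
    | _ \<Rightarrow> (3, 3, 3, 20))"

definition cert_SG :: "front \<Rightarrow> front \<Rightarrow> cert" where
  "cert_SG b c = (case b of
    P0 \<Rightarrow> (case c of P0 \<Rightarrow> (2, 2, 1, 10) | P1 \<Rightarrow> (1, 1, 1, 8) | SG \<Rightarrow> (2, 2, 1, 10) | SF \<Rightarrow> (2, 2, 1, 10) | T0 \<Rightarrow> (1, 2, 1, 13) | _ \<Rightarrow> (3, 3, 3, 20))
    | P1 \<Rightarrow> (case c of P0 \<Rightarrow> (1, 1, 0, 7) | P1 \<Rightarrow> (0, 1, 0, 4) | SG \<Rightarrow> (1, 1, 0, 4) | SF \<Rightarrow> (1, 1, 0, 4) | _ \<Rightarrow> (3, 3, 3, 20))
    | S0 \<Rightarrow> (case c of FF \<Rightarrow> (2, 1, 2, 14) | T0 \<Rightarrow> (3, 3, 3, 19) | T1 \<Rightarrow> (2, 1, 2, 14) | _ \<Rightarrow> (3, 3, 3, 20))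
    | SG \<Rightarrow> (case c of P0 \<Rightarrow> (2, 1, 1, 10) | P1 \<Rightarrow> (1, 1, 1, 5) | SG \<Rightarrow> (2, 1, 1, 10) | SF \<Rightarrow> (2, 1, 1, 10) | FF \<Rightarrow> (1, 2, 1, 10) | _ \<Rightarrow> (3, 3, 3, 20))
    | SF \<Rightarrow> (case c of P0 \<Rightarrow> (2, 1, 1, 10) | P1 \<Rightarrow> (1, 1, 1, 7) | SG \<Rightarrow> (2, 1, 1, 10) | SF \<Rightarrow> (2, 1, 1, 10) | T0 \<Rightarrow> (1, 1, 1, 7) | T1 \<Rightarrow> (1, 2, 1, 13) | _ \<Rightarrow> (3, 3, 3, 20))
    | FF \<Rightarrow> (case c of S0 \<Rightarrow> (1, 1, 1, 20) | SG \<Rightarrow> (1, 1, 1, 9) | FF \<Rightarrow> (2, 1, 2, 16) | T0 \<Rightarrow> (2, 2, 2, 13) | T1 \<Rightarrow> (2, 1, 2, 16) | _ \<Rightarrow> (3, 3, 3, 20))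
    | _ \<Rightarrow> (3, 3, 3, 20))"

definition cert_SF :: "front \<Rightarrow> front \<Rightarrow> cert" where
  "cert_SF b c = (case b of
    P0 \<Rightarrow> (case c of P0 \<Rightarrow> (1, 2, 1, 10) | P1 \<Rightarrow> (0, 1, 1, 6) | SG \<Rightarrow> (1, 2, 1, 10) | SF \<Rightarrow> (1, 2, 1, 7) | T0 \<Rightarrow> (1, 1, 1, 12) | _ \<Rightarrow> (3, 3, 3, 20))
    | P1 \<Rightarrow> (case c of P0 \<Rightarrow> (1, 1, 0, 7) | P1 \<Rightarrow> (0, 1, 0, 3) | SG \<Rightarrow> (0, 1, 0, 4) | SF \<Rightarrow> (1, 1, 0, 7) | _ \<Rightarrow> (3, 3, 3, 20))
    | S0 \<Rightarrow> (case c of FF \<Rightarrow> (1, 1, 2, 11) | T0 \<Rightarrow> (3, 3, 3, 19) | T1 \<Rightarrow> (1, 1, 2, 12) | _ \<Rightarrow> (3, 3, 3, 20))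
    | SG \<Rightarrow> (case c of P0 \<Rightarrow> (1, 1, 1, 10) | P1 \<Rightarrow> (0, 1, 1, 5) | SG \<Rightarrow> (1, 1, 1, 10) | SF \<Rightarrow> (1, 1, 1, 7) | FF \<Rightarrow> (1, 1, 1, 11) | _ \<Rightarrow> (3, 3, 3, 20))
    | SF \<Rightarrow> (case c of P0 \<Rightarrow> (1, 1, 1, 10) | P1 \<Rightarrow> (0, 1, 1, 3) | SG \<Rightarrow> (1, 1, 1, 10) | SF \<Rightarrow> (1, 1, 1, 7) | T0 \<Rightarrow> (1, 1, 1, 8) | T1 \<Rightarrow> (1, 1, 1, 12) | _ \<Rightarrow> (3, 3, 3, 20))
    | T0 \<Rightarrow> (case c of P0 \<Rightarrow> (1, 1, 1, 9) | S0 \<Rightarrow> (3, 3, 3, 19) | SF \<Rightarrow> (0, 1, 1, 6) | FF \<Rightarrow> (1, 2, 2, 15) | T0 \<Rightarrow> (1, 1, 2, 12) | T1 \<Rightarrow> (1, 2, 2, 15) | _ \<Rightarrow> (3, 3, 3, 20))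
    | T1 \<Rightarrow> (case c of S0 \<Rightarrow> (1, 1, 1, 10) | SF \<Rightarrow> (1, 1, 1, 9) | FF \<Rightarrow> (2, 1, 2, 17) | T0 \<Rightarrow> (2, 2, 2, 13) | T1 \<Rightarrow> (2, 1, 2, 18) | _ \<Rightarrow> (3, 3, 3, 20))
    | _ \<Rightarrow> (3, 3, 3, 20))"

definition cert_FF :: "front \<Rightarrow> front \<Rightarrow> cert" where
  "cert_FF b c = (case b of
    S0 \<Rightarrow> (case c of P0 \<Rightarrow> (2, 1, 1, 14) | P1 \<Rightarrow> (1, 1, 1, 8) | SG \<Rightarrow> (2, 1, 1, 14) | SF \<Rightarrow> (2, 1, 1, 11) | FF \<Rightarrow> (2, 1, 2, 14) | T0 \<Rightarrow> (2, 1, 2, 14) | T1 \<Rightarrow> (2, 1, 2, 17) | _ \<Rightarrow> (3, 3, 3, 20))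
    | SG \<Rightarrow> (case c of P0 \<Rightarrow> (2, 1, 1, 11) | P1 \<Rightarrow> (1, 1, 1, 9) | SG \<Rightarrow> (1, 1, 1, 10) | SF \<Rightarrow> (1, 1, 1, 11) | _ \<Rightarrow> (3, 3, 3, 20))
    | FF \<Rightarrow> (case c of S0 \<Rightarrow> (2, 2, 2, 15) | SG \<Rightarrow> (1, 2, 2, 16) | FF \<Rightarrow> (2, 2, 3, 20) | T0 \<Rightarrow> (3, 2, 3, 20) | T1 \<Rightarrow> (2, 2, 3, 20) | _ \<Rightarrow> (3, 3, 3, 20))
    | T0 \<Rightarrow> (case c of P0 \<Rightarrow> (2, 2, 2, 17) | SF \<Rightarrow> (1, 2, 2, 15) | FF \<Rightarrow> (2, 2, 3, 20) | T0 \<Rightarrow> (2, 2, 3, 20) | T1 \<Rightarrow> (2, 2, 3, 20) | _ \<Rightarrow> (3, 3, 3, 20))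
    | T1 \<Rightarrow> (case c of S0 \<Rightarrow> (2, 2, 2, 18) | SF \<Rightarrow> (2, 2, 2, 17) | FF \<Rightarrow> (3, 2, 3, 20) | T0 \<Rightarrow> (3, 2, 3, 20) | T1 \<Rightarrow> (3, 2, 3, 20) | _ \<Rightarrow> (3, 3, 3, 20))
    | _ \<Rightarrow> (3, 3, 3, 20))"

definition cert_T0 :: "front \<Rightarrow> front \<Rightarrow> cert" where
  "cert_T0 b c = (case b of
    P0 \<Rightarrow> (case c of P0 \<Rightarrow> (2, 2, 1, 13) | P1 \<Rightarrow> (1, 2, 1, 9) | SG \<Rightarrow> (1, 2, 1, 13) | SF \<Rightarrow> (1, 1, 1, 12) | _ \<Rightarrow> (3, 3, 3, 20))
    | S0 \<Rightarrow> (case c of P0 \<Rightarrow> (3, 3, 3, 19) | P1 \<Rightarrow> (3, 3, 3, 19) | SG \<Rightarrow> (3, 3, 3, 19) | SF \<Rightarrow> (3, 3, 3, 19) | FF \<Rightarrow> (2, 2, 1, 14) | _ \<Rightarrow> (3, 3, 3, 20))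
    | SF \<Rightarrow> (case c of P0 \<Rightarrow> (2, 1, 0, 8) | P1 \<Rightarrow> (1, 1, 1, 7) | SG \<Rightarrow> (1, 1, 0, 7) | SF \<Rightarrow> (1, 1, 0, 8) | T0 \<Rightarrow> (2, 1, 2, 11) | T1 \<Rightarrow> (2, 2, 1, 16) | _ \<Rightarrow> (3, 3, 3, 20))
    | FF \<Rightarrow> (case c of S0 \<Rightarrow> (2, 2, 1, 15) | SG \<Rightarrow> (1, 2, 1, 13) | FF \<Rightarrow> (2, 3, 2, 20) | T0 \<Rightarrow> (2, 2, 2, 17) | T1 \<Rightarrow> (2, 3, 2, 20) | _ \<Rightarrow> (3, 3, 3, 20))
    | T0 \<Rightarrow> (case c of P0 \<Rightarrow> (2, 2, 1, 13) | SF \<Rightarrow> (1, 2, 2, 12) | FF \<Rightarrow> (2, 2, 2, 20) | T0 \<Rightarrow> (3, 2, 3, 17) | T1 \<Rightarrow> (2, 3, 3, 20) | _ \<Rightarrow> (3, 3, 3, 20))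
    | T1 \<Rightarrow> (case c of S0 \<Rightarrow> (2, 2, 1, 16) | SF \<Rightarrow> (2, 2, 1, 13) | FF \<Rightarrow> (3, 3, 2, 20) | T0 \<Rightarrow> (3, 2, 2, 17) | T1 \<Rightarrow> (3, 3, 2, 20) | _ \<Rightarrow> (3, 3, 3, 20))
    | _ \<Rightarrow> (3, 3, 3, 20))"

definition cert_T1 :: "front \<Rightarrow> front \<Rightarrow> cert" where
  "cert_T1 b c = (case b of
    S0 \<Rightarrow> (case c of P0 \<Rightarrow> (2, 1, 1, 14) | P1 \<Rightarrow> (1, 1, 1, 9) | SG \<Rightarrow> (2, 1, 1, 14) | SF \<Rightarrow> (2, 1, 1, 12) | FF \<Rightarrow> (2, 1, 2, 17) | T1 \<Rightarrow> (2, 1, 2, 17) | _ \<Rightarrow> (3, 3, 3, 20))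
    | SF \<Rightarrow> (case c of P0 \<Rightarrow> (2, 2, 1, 13) | P1 \<Rightarrow> (1, 1, 1, 9) | SG \<Rightarrow> (1, 2, 1, 13) | SF \<Rightarrow> (1, 1, 1, 12) | T0 \<Rightarrow> (2, 2, 2, 16) | T1 \<Rightarrow> (2, 2, 2, 18) | _ \<Rightarrow> (3, 3, 3, 20))
    | FF \<Rightarrow> (case c of S0 \<Rightarrow> (2, 2, 2, 15) | SG \<Rightarrow> (1, 2, 2, 16) | FF \<Rightarrow> (2, 2, 3, 20) | T1 \<Rightarrow> (2, 2, 3, 20) | _ \<Rightarrow> (3, 3, 3, 20))
    | T0 \<Rightarrow> (case c of P0 \<Rightarrow> (2, 2, 2, 18) | SF \<Rightarrow> (1, 2, 2, 15) | FF \<Rightarrow> (2, 3, 3, 20) | T0 \<Rightarrow> (2, 2, 3, 20) | T1 \<Rightarrow> (2, 3, 3, 20) | _ \<Rightarrow> (3, 3, 3, 20))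
    | T1 \<Rightarrow> (case c of S0 \<Rightarrow> (2, 2, 2, 18) | SF \<Rightarrow> (2, 2, 2, 18) | FF \<Rightarrow> (3, 2, 3, 20) | T1 \<Rightarrow> (3, 2, 3, 20) | _ \<Rightarrow> (3, 3, 3, 20))
    | _ \<Rightarrow> (3, 3, 3, 20))"

text \<open>The default \<open>(3, 3, 3, 20)\<close> of the tables is the largest value of each
  component. A large potential eases the edges leaving a state and burdens those entering
  it.\<close>

definition cert :: "front \<Rightarrow> front \<Rightarrow> front \<Rightarrow> cert" where
  "cert a b c = (case a of P0 \<Rightarrow> cert_P0 b c | P1 \<Rightarrow> cert_P1 b c | S0 \<Rightarrow> cert_S0 b c | SG \<Rightarrow> cert_SG b c | SF \<Rightarrow> cert_SF b c | FF \<Rightarrow> cert_FF b c | T0 \<Rightarrow> cert_T0 b c | T1 \<Rightarrow> cert_T1 b c)"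
definition middle :: "front \<Rightarrow> front \<Rightarrow> front \<Rightarrow> bool" where
  "middle s1 s2 s3 \<longleftrightarrow> s2 = FF \<and> (s1 = S0 \<and> s3 = SG \<or> s1 = SG \<and> s3 = S0)"

text \<open>A column with \<open>w\<close> guards has excess \<open>w - 1\<close>. The first three
  inequalities let the potential grow by at most this excess while the phase advances by one modulo
  3. The fourth potential counts ninths of a guard and grows by at most
  \<open>9 * (w - 1) - 1\<close>; this is waived for steps into a \<open>middle\<close>
  state.\<close>

definition edge_ok :: "cert \<Rightarrow> nat \<Rightarrow> bool \<Rightarrow> cert \<Rightarrow> bool" where
  "edge_ok u w skip v = (case u of (f0, f1, f2, p) \<Rightarrow> case v of (g0, g1, g2, q) \<Rightarrow>
     Suc g1 \<le> f0 + w \<and> Suc g2 \<le> f1 + w \<and> Suc g0 \<le> f2 + w \<and> (skip \<or> q + 10 \<le> p + 9 * w))"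

section \<open>Exhaustive check of the certificate\<close>

definition all_labels :: "(label \<Rightarrow> bool) \<Rightarrow> bool" where
  "all_labels Q \<longleftrightarrow> Q Private \<and> Q Shared \<and> Q Free \<and> Q Bound"

definition all_fronts :: "(front \<Rightarrow> bool) \<Rightarrow> bool" where
  "all_fronts Q \<longleftrightarrow> Q P0 \<and> Q P1 \<and> Q S0 \<and> Q SG \<and> Q SF \<and> Q FF \<and> Q T0 \<and> Q T1"

text \<open>Runs over all triples of fronts, reachable or not, and all columns that may follow. A
  front determines the label of its cell, so the left neighbours of the new column are known.
  Keeping \<open>s1\<close> as a parameter splits the check into eight evaluations.\<close>

definition certified :: "front \<Rightarrow> bool" where
  "certified s1 \<longleftrightarrow> all_fronts (\<lambda>s2. all_fronts (\<lambda>s3.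
     all_labels (\<lambda>a. admits s1 a \<longrightarrow>
     all_labels (\<lambda>b. live a [label_of s1, b] \<and> admits s2 b \<longrightarrow>
     all_labels (\<lambda>c. live b [label_of s2, a, c] \<and> admits s3 c \<and> live c [label_of s3, b] \<longrightarrow>
       (let t1 = advance a [label_of s1, b]; t2 = advance b [label_of s2, a, c];
            t3 = advance c [label_of s3, b]
        in edge_ok (cert s1 s2 s3) (weight a b c) (middle t1 t2 t3) (cert t1 t2 t3)))))))"

lemma certified_P0: "certified P0" by code_simp
lemma certified_P1: "certified P1" by code_simp
lemma certified_S0: "certified S0" by code_simp
lemma certified_SG: "certified SG" by code_simp
lemma certified_SF: "certified SF" by code_simp
lemma certified_FF: "certified FF" by code_simp
lemma certified_T0: "certified T0" by code_simp
lemma certified_T1: "certified T1" by code_simp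

lemma all_labels_iff: "all_labels Q \<longleftrightarrow> (\<forall>l. Q l)"
  unfolding all_labels_def by (metis label.exhaust)

lemma all_fronts_iff: "all_fronts Q \<longleftrightarrow> (\<forall>s. Q s)"
  unfolding all_fronts_def by (metis front.exhaust)

lemma cert_edge:
  assumes "admits s1 a" "admits s2 b" "admits s3 c"
    and "live a [label_of s1, b]" "live b [label_of s2, a, c]" "live c [label_of s3, b]"
    and "t1 = advance a [label_of s1, b]" "t2 = advance b [label_of s2, a, c]"
    and "t3 = advance c [label_of s3, b]"
  shows "edge_ok (cert s1 s2 s3) (weight a b c) (middle t1 t2 t3) (cert t1 t2 t3)"
proof -
  have "certified s1"
    by (cases s1) (simp_all only: certified_P0 certified_P1 certified_S0 certified_SG certified_SF
      certified_FF certified_T0 certified_T1)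
  then show ?thesis
    using assms unfolding certified_def all_labels_iff all_fronts_iff Let_def by blast
qed

subsection \<open>Lower bounds\<close>

text \<open>Index \<open>i\<close> denotes the front left behind by column \<open>i + 1\<close>,
  whose left neighbour is column \<open>i\<close>.\<close>

definition outer_front :: "(nat \<Rightarrow> label) \<Rightarrow> (nat \<Rightarrow> label) \<Rightarrow> nat \<Rightarrow> front" where
  "outer_front a b i = advance (a (i + 1)) [a i, b (i + 1)]"

definition inner_front :: "(nat \<Rightarrow> label) \<Rightarrow> (nat \<Rightarrow> label) \<Rightarrow> (nat \<Rightarrow> label) \<Rightarrow> nat \<Rightarrow> front" where
  "inner_front a b c i = advance (b (i + 1)) [b i, a (i + 1), c (i + 1)]"

context
  fixes a b c :: "nat \<Rightarrow> label" and n :: nat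
  assumes strip: "strip a b c"
    and period: "\<And>i. a (i + n) = a i" "\<And>i. b (i + n) = b i" "\<And>i. c (i + n) = c i"
begin

abbreviation "cost i \<equiv> weight (a i) (b i) (c i)"
abbreviation "cert_at i \<equiv> cert (outer_front a b i) (inner_front a b c i) (outer_front c b i)"
abbreviation "middle_at i \<equiv> middle (outer_front a b i) (inner_front a b c i) (outer_front c b i)"

text \<open>\<open>strip\<close> at \<open>i\<close> makes the fronts of column \<open>i + 1\<close>
  admit column \<open>i + 2\<close>, and \<open>strip\<close> at \<open>Suc i\<close> makes column
  \<open>i + 2\<close> live. So this edge pays for column \<open>i + 2\<close>.\<close>

lemma edge_Suc:
  "edge_ok (cert_at i) (cost (i + 2)) (middle_at (Suc i)) (cert_at (Suc i))"
  using strip[unfolded strip_def, rule_format, of i] strip[unfolded strip_def, rule_format, of "Suc i"]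
  by (intro cert_edge) (simp_all add: cell_ok_Cons outer_front_def inner_front_def)

lemma sum_cost_shift: "(\<Sum>j<n. cost (i + j)) = (\<Sum>j<n. cost j)"
proof (induction i)
  case (Suc i)
  have "cost (i + n) = cost i"
    by (simp add: period)
  then have "(\<Sum>j<n. cost (Suc i + j)) = (\<Sum>j<n. cost (i + j))"
    using sum.lessThan_Suc[of "\<lambda>j. cost (i + j)" n] sum.lessThan_Suc_shift[of "\<lambda>j. cost (i + j)" n]
    by simp
  then show ?case
    using Suc by simp
qed simp

lemma fronts_period:
  "outer_front a b (i + n) = outer_front a b i"
  "inner_front a b c (i + n) = inner_front a b c i"
  "outer_front c b (i + n) = outer_front c b i"
  using period[of i] period[of "Suc i"] by (simp_all add: outer_front_def inner_front_def)

text \<open>The inequalities telescope over one period: the walk is back in the same state with its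
  phase advanced by \<open>n\<close>, so the total excess is at least the difference of two
  potentials at \<open>(S0, FF, SG)\<close>.\<close>

lemma lower_bound_via_diagonal:
  assumes "outer_front a b i = S0" "inner_front a b c i = FF" "outer_front c b i = SG"
  shows "3 * ((n + 2) div 3) \<le> (\<Sum>j<n. cost j)"
proof -
  define phase :: "nat \<Rightarrow> cert \<Rightarrow> nat" where
    "phase k v = (if k mod 3 = 0 then fst v else if k mod 3 = 1 then fst (snd v) else fst (snd (snd v)))"
    for k v
  have step: "phase (Suc k) (cert_at (Suc i)) + 1 \<le> phase k (cert_at i) + cost (i + 2)" for k i
  proof -
    have "Suc k mod 3 = (if k mod 3 = 2 then 0 else Suc (k mod 3))" "k mod 3 < 3"
      by (simp_all add: mod_Suc)
    then show ?thesis
      using edge_Suc[of i] by (auto simp: phase_def edge_ok_def split: prod.splits if_splits)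
  qed
  have "phase k (cert_at (i + k)) + k \<le> phase 0 (cert_at i) + (\<Sum>j<k. cost (i + 2 + j))" for k
  proof (induction k)
    case (Suc k)
    then show ?case
      using step[of k "i + k"] by (simp add: add_ac)
  qed simp
  from this[of n] have "phase n (cert_at (i + n)) + n \<le> phase 0 (cert_at i) + (\<Sum>j<n. cost j)"
    by (simp only: sum_cost_shift)
  \<comment> \<open>Phases 0, 1, 2 carry the values 0, 2, 1, exactly what rounds \<open>n\<close> up
    to a multiple of 3.\<close>
  moreover obtain p where "cert S0 FF SG = (0, 2, 1, p)"
    by (simp add: cert_def cert_S0_def)
  then have "cert_at (i + n) = (0, 2, 1, p)" "cert_at i = (0, 2, 1, p)"
    by (simp_all only: fronts_period assms)
  ultimately have "(if n mod 3 = 0 then 0 else if n mod 3 = 1 then 2 else 1) + n \<le> (\<Sum>j<n. cost j)"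
    by (auto simp: phase_def split: if_splits)
  moreover have "3 * ((n + 2) div 3) = (if n mod 3 = 0 then 0 else if n mod 3 = 1 then 2 else 1) + n"
    by presburger
  ultimately show ?thesis
    by simp
qed

text \<open>No step enters a \<open>middle\<close> state and the fourth potential has its old value
  after one period, so its inequalities telescope to an excess of at least
  \<open>n / 9\<close>.\<close>

lemma lower_bound_avoiding_diagonal:
  assumes "\<And>i. \<not> middle_at i"
  shows "10 * n \<le> 9 * (\<Sum>j<n. cost j)"
proof -
  define pot where "pot i = snd (snd (snd (cert_at i)))" for i
  have step: "pot (Suc i) + 10 \<le> pot i + 9 * cost (i + 2)" for i
    using edge_Suc[of i] assms by (simp add: pot_def edge_ok_def split: prod.splits)
  have "pot k + 10 * k \<le> pot 0 + 9 * (\<Sum>j<k. cost (2 + j))" for k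
  proof (induction k)
    case (Suc k)
    then show ?case
      using step[of k] by (simp add: add_ac)
  qed simp
  from this[of n] have "pot n + 10 * n \<le> pot 0 + 9 * (\<Sum>j<n. cost j)"
    by (simp only: sum_cost_shift)
  moreover have "pot n = pot 0"
    using fronts_period[of 0] by (simp add: pot_def)
  ultimately show ?thesis
    by simp
qed

end

text \<open>The diagonal bound is anchored at \<open>(S0, FF, SG)\<close>; reflection brings the
  other \<open>middle\<close> state there.\<close>

lemma strip_mirror:
  assumes "strip a b c"
  shows "strip c b a"
  unfolding strip_def
proof
  fix i
  have "cell_ok (b (i + 1)) [b (i + 2), b i, a (i + 1), c (i + 1)] =
      cell_ok (b (i + 1)) [b (i + 2), b i, c (i + 1), a (i + 1)]"
    by (rule cell_ok_cong) simp
  then show "cell_ok (c (i + 1)) [c (i + 2), c i, b (i + 1)] \<and>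
      cell_ok (b (i + 1)) [b (i + 2), b i, c (i + 1), a (i + 1)] \<and>
      cell_ok (a (i + 1)) [a (i + 2), a i, b (i + 1)]"
    using assms[unfolded strip_def, rule_format, of i] by blast
qed

lemma lower_bound_three:
  assumes "secure_dominating (cylinder 3) D"
  shows "3 \<le> card D"
proof -
  have D: "D \<subseteq> {0..<3} \<times> {0..<3}"
    using assms by (simp add: secure_dominating_def pverts_cylinder)
  then have fin: "finite D"
    by (rule finite_subset) simp
  have three: "3 \<le> card D" if "{u, v, w} \<subseteq> D" "u \<noteq> v" "u \<noteq> w" "v \<noteq> w" for u v w
    using card_mono[OF fin that(1)] that(2-) by simp
  have dom: "(r, j) \<in> D \<or> (\<exists>w \<in> D. ((r, j), w) \<in> parcs (cylinder 3))" if "r < 3" "j < 3" for r j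
    using assms that unfolding secure_dominating_def pverts_cylinder by fastforce
  have outer: "3 \<le> card D" if "r = 0 \<or> r = 2" "\<forall>j. (r, j) \<notin> D" for r
  proof -
    have "(1, j) \<in> D" if "j < 3" for j
      using dom[of r j] \<open>r = 0 \<or> r = 2\<close> \<open>\<forall>j. (r, j) \<notin> D\<close> that
      by (auto simp: cylinder_arc_iff)
    then show ?thesis
      by (intro three[of "(1, 0)" "(1, 1)" "(1, 2)"]) auto
  qed
  show ?thesis
  proof (cases "\<exists>p q. (0, p) \<in> D \<and> (2, q) \<in> D")
    case True
    then obtain p q where pq: "(0, p) \<in> D" "(2, q) \<in> D"
      by blast
    have "\<exists>j<3. j \<noteq> p \<and> j \<noteq> q"
      by presburger
    then obtain j where j: "j < 3" "j \<noteq> p" "j \<noteq> q"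
      by blast
    obtain w where "w \<in> D" "w \<noteq> (0, p)" "w \<noteq> (2, q)"
      using dom[of 1 j] j by (auto simp: cylinder_arc_iff)
    then show ?thesis
      using pq by (intro three[of "(0, p)" "(2, q)" w]) auto
  next
    case False
    then show ?thesis
      using outer by blast
  qed
qed

lemma lower_bound:
  assumes n: "n \<ge> 4" and sec: "secure_dominating (cylinder n) D"
  shows "(if n = 4 \<or> n = 7 then n + 1 else 3 * ((n + 2) div 3)) \<le> card D"
proof -
  obtain a b c where strip: "strip a b c"
    and per: "\<And>i. a (i + n) = a i" "\<And>i. b (i + n) = b i" "\<And>i. c (i + n) = c i"
    and card: "card D = (\<Sum>j<n. weight (a j) (b j) (c j))"
    using strip_of_secure_dominating[OF n sec] by blast
  have card': "card D = (\<Sum>j<n. weight (c j) (b j) (a j))"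
    unfolding card weight_def by (intro sum.cong) simp_all
  have mirror: "inner_front c b a i = inner_front a b c i" for i
    by (auto simp: inner_front_def intro: advance_cong)
  consider (avoid) "\<forall>i. \<not> middle (outer_front a b i) (inner_front a b c i) (outer_front c b i)"
    | (diagonal) i where "outer_front a b i = S0" "inner_front a b c i = FF" "outer_front c b i = SG"
    | (antidiagonal) i where "outer_front a b i = SG" "inner_front a b c i = FF" "outer_front c b i = S0"
    unfolding middle_def by blast
  then have "3 * ((n + 2) div 3) \<le> card D \<or> 10 * n \<le> 9 * card D"
  proof cases
    case avoid
    then show ?thesis
      using lower_bound_avoiding_diagonal[of a b c n, OF strip per] by (simp add: card)
  next
    case diagonal
    then show ?thesis
      using lower_bound_via_diagonal[of a b c n, OF strip per diagonal] by (simp add: card)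
  next
    case antidiagonal
    then show ?thesis
      using lower_bound_via_diagonal[of c b a n i, OF strip_mirror[OF strip] per(3,2,1)]
      by (simp add: mirror card')
  qed
  then show ?thesis
  proof
    \<comment> \<open>This gives at least \<open>n + 1\<close> guards, which is enough unless
      \<open>n mod 3 = 1\<close> and \<open>n\<close> is neither 4 nor 7. Then
      \<open>n \<ge> 10\<close>, so \<open>10 * n\<close> exceeds \<open>9 * (n + 1)\<close> and
      there are at least \<open>n + 2\<close> guards.\<close>
    assume *: "10 * n \<le> 9 * card D"
    have "3 * ((n + 2) div 3) \<le> n + 2" "n mod 3 = 2 \<Longrightarrow> 3 * ((n + 2) div 3) = n + 1"
        "n mod 3 = 0 \<Longrightarrow> 3 * ((n + 2) div 3) = n"
      by presburger+
    moreover have "n mod 3 = 1 \<Longrightarrow> n = 4 \<or> n = 7 \<or> n \<ge> 10"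
      using n by presburger
    moreover have "n mod 3 = 0 \<or> n mod 3 = 1 \<or> n mod 3 = 2"
      by presburger
    ultimately show ?thesis
      using * n by auto
  qed auto
qed

theorem theorem32:
  fixes n :: nat
  assumes "n \<ge> 3"
  shows "secure_domination_number (cartesian_product (path_graph 3) (cycle_graph n)) =
    (if n = 4 \<or> n = 7 then n + 1 else 3 * nat \<lceil>real n / 3\<rceil>)"
proof -
  obtain D where D: "secure_dominating (cylinder n) D" "card D = secure_domination_number (cylinder n)"
    using secure_domination_number_attained by blast
  have lower: "(if n = 4 \<or> n = 7 then n + 1 else 3 * ((n + 2) div 3)) \<le> secure_domination_number (cylinder n)"
    using lower_bound[of n D] lower_bound_three[of D] D assms by (cases "n = 3") auto
  have "\<lceil>real n / 3\<rceil> = int ((n + 2) div 3)"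
    by (rule ceiling_unique) (use div_mult_mod_eq[of "n + 2" 3] in linarith)+
  then have ceiling: "nat \<lceil>real n / 3\<rceil> = (n + 2) div 3"
    by simp
  show ?thesis
    unfolding ceiling by (rule antisym[OF upper_bound[OF assms] lower])
qed

end
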